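(* Let $p\ge 5$ be a prime, let $a\in\mathbb{Z}_p^{\times}$ be panmagic, and let $N:=\operatorname{ord}_p(a^2)+1$. Then the coset $C:=\pi_aD_p$ consists of panmagic permutations and is strictly $N$-ary. Moreover, $$\langle\pi_a,D_p\rangle=\bigcup_{i=1}^{N-1}C^i,$$ $D_p$ is a normal subgroup of this group, and the quotient group is $\langle\pi_a,D_p\rangle/D_p\simeq\mathbb{Z}_{N-1}$.
   Context: $S_n$ is the group of permutations of $\{1,\dots,n\}$, identified with the group of permutations of the residues $\mathbb{Z}_n$ (with $n$ identified with the residue $0$); products are compositions. The permutation matrix of $\sigma\in S_n$ is $P_\sigma$ with $P_\sigma e_i=e_{\sigma(i)}$. The broken diagonals of an $n\times n$ matrix are the sets of positions $(i,j)$ with $i-j\equiv c \pmod n$, and the broken anti-diagonals are the sets of positions with $i+j\equiv c\pmod n$, for constant $c$. A permutation $\sigma\in S_n$ is panmagic if the sum of the entries of $P_\sigma$ over every broken diagonal and every broken anti-diagonal equals $1$. $\phi(i)=n+1-i\equiv 1-i$ is the flip and $\varkappa(i)\equiv i+1\pmod n$ is the cyclic shift; $D_n:=\langle\phi,\varkappa\rangle\le S_n$ is the dihedral group. For $a\in\mathbb{Z}_n^\times$ (the units of $\mathbb{Z}_n$), $\pi_a\in S_n$ is $\pi_a(i)\equiv ai\pmod n$. A unit $a\in\mathbb{Z}_n^\times$ is called panmagic if $a+1$ and $a-1$ are also units; for $n=p$ prime this means $a\ne 0,\pm1$. $\operatorname{ord}_p(x)$ is the multiplicative order of $x\in\mathbb{Z}_p^\times$.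 For a subset $C$ of a group, $C^i$ denotes the set of all products of $i$ elements of $C$. For $N\ge2$, $C$ is closed under $N$-ary multiplication if $a_1\cdots a_N\in C$ for all $a_1,\dots,a_N\in C$. $C$ is strictly $N$-ary if it is closed under $N$-ary multiplication but not under $N'$-ary multiplication for any $N'$ with $2\le N'<N$. $\langle S\rangle$ denotes the subgroup generated by $S$; $\langle\pi_a,D_p\rangle$ is generated by $\pi_a$ and $D_p$ jointly. *)

theory Defs
  imports "HOL-Algebra.Sym_Groups" "HOL-Algebra.Elementary_Groups" "HOL-Number_Theory.Residues"
begin

text \<open>The symmetric group \<open>sym_group n\<close> acts on \<open>{1..n}\<close>. The residue classes modulo \<open>n\<close>
  are identified with \<open>{1..n}\<close> by sending a class to its unique member of \<open>{1..n}\<close>, so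
  that the class of 0 corresponds to \<open>n\<close>. Elements of \<open>sym_group n\<close> are functions on all
  of \<open>nat\<close> that are the identity outside \<open>{1..n}\<close>.\<close>

definition residue_rep :: "nat \<Rightarrow> int \<Rightarrow> nat" where
  "residue_rep n k = nat ((k - 1) mod int n) + 1"

lemma residue_rep_in: "n \<ge> 1 \<Longrightarrow> residue_rep n k \<in> {1..n}"
proof -
  assume "n \<ge> 1"
  then have "(k - 1) mod int n < int n" by simp
  then show ?thesis
    using \<open>n \<ge> 1\<close> by (simp add: residue_rep_def Suc_le_eq nat_less_iff)
qed

lemma residue_rep_cong: "n \<ge> 1 \<Longrightarrow> [int (residue_rep n k) = k] (mod int n)"
  by (simp add: residue_rep_def cong_def mod_simps)

definition flip :: "nat \<Rightarrow> nat \<Rightarrow> nat" where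
  "flip n i = (if i \<in> {1..n} then n + 1 - i else i)"

definition cyc_shift :: "nat \<Rightarrow> nat \<Rightarrow> nat" where
  "cyc_shift n i = (if i \<in> {1..n} then residue_rep n (int i + 1) else i)"

definition mult_perm :: "nat \<Rightarrow> int \<Rightarrow> nat \<Rightarrow> nat" where
  "mult_perm n a i = (if i \<in> {1..n} then residue_rep n (a * int i) else i)"

definition dihedral :: "nat \<Rightarrow> (nat \<Rightarrow> nat) set" where
  "dihedral n = generate (sym_group n) {flip n, cyc_shift n}"

text \<open>Matrices are indexed by \<open>{1..n} \<times> {1..n}\<close>. By \<open>P e_j = e_(\<sigma> j)\<close>,
  column \<open>j\<close> has its 1 in row \<open>\<sigma> j\<close>.\<close>

definition perm_matrix :: "(nat \<Rightarrow> nat) \<Rightarrow> nat \<times> nat \<Rightarrow> int" where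
  "perm_matrix \<sigma> = (\<lambda>(i, j). if i = \<sigma> j then 1 else 0)"

definition broken_diagonal :: "nat \<Rightarrow> int \<Rightarrow> (nat \<times> nat) set" where
  "broken_diagonal n c = {(i, j) \<in> {1..n} \<times> {1..n}. [int i - int j = c] (mod int n)}"

definition broken_antidiagonal :: "nat \<Rightarrow> int \<Rightarrow> (nat \<times> nat) set" where
  "broken_antidiagonal n c = {(i, j) \<in> {1..n} \<times> {1..n}. [int i + int j = c] (mod int n)}"

definition panmagic_perm :: "nat \<Rightarrow> (nat \<Rightarrow> nat) \<Rightarrow> bool" where
  "panmagic_perm n \<sigma> \<longleftrightarrow> \<sigma> permutes {1..n} \<and>
     (\<forall>c. sum (perm_matrix \<sigma>) (broken_diagonal n c) = 1 \<and>
          sum (perm_matrix \<sigma>) (broken_antidiagonal n c) = 1)"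

text \<open>For \<open>n \<ge> 2\<close>; the library's \<open>residue_ring 1\<close> is degenerate.\<close>

definition panmagic_unit :: "nat \<Rightarrow> int \<Rightarrow> bool" where
  "panmagic_unit n a \<longleftrightarrow> (let R = residue_ring (int n) in
     a \<in> Units R \<and> a \<oplus>\<^bsub>R\<^esub> \<one>\<^bsub>R\<^esub> \<in> Units R \<and> a \<ominus>\<^bsub>R\<^esub> \<one>\<^bsub>R\<^esub> \<in> Units R)"

definition set_power :: "('a, 'b) monoid_scheme \<Rightarrow> 'a set \<Rightarrow> nat \<Rightarrow> 'a set" where
  "set_power G C i =
     {foldr (\<lambda>x y. x \<otimes>\<^bsub>G\<^esub> y) xs \<one>\<^bsub>G\<^esub> | xs. length xs = i \<and> set xs \<subseteq> C}"

definition closed_nary :: "('a, 'b) monoid_scheme \<Rightarrow> 'a set \<Rightarrow> nat \<Rightarrow> bool" where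
  "closed_nary G C N \<longleftrightarrow> set_power G C N \<subseteq> C"

definition strictly_nary :: "('a, 'b) monoid_scheme \<Rightarrow> 'a set \<Rightarrow> nat \<Rightarrow> bool" where
  "strictly_nary G C N \<longleftrightarrow>
     N \<ge> 2 \<and> closed_nary G C N \<and> (\<forall>N'. 2 \<le> N' \<and> N' < N \<longrightarrow> \<not> closed_nary G C N')"

end

theory Submission
  imports Defs
begin

text \<open>Everything takes place inside the group of affine permutations \<open>i \<mapsto> u i + b\<close> of the residues
modulo \<open>p\<close>. The dihedral group \<open>D\<close> consists of the affine maps of slope \<open>\<plusminus>1\<close>, and \<open>C = \<pi>\<^sub>a D\<close> of
those of slope \<open>\<plusminus>a\<close>.

An affine permutation of slope \<open>u\<close> is panmagic as soon as \<open>u\<close>, \<open>u + 1\<close> and \<open>u - 1\<close> are units, because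
\<open>j \<mapsto> \<sigma> j \<plusminus> j\<close> is then again a bijection of the residues (lemma \<open>panmagic_affine_perm\<close>). This
condition is symmetric under \<open>u \<mapsto> -u\<close>, so if it holds for \<open>a\<close> it holds for all slopes occurring
in \<open>C\<close>.

For the rest, \<open>\<pi>\<^sub>a D = D \<pi>\<^sub>a\<close>, and \<open>\<pi>\<^sub>a\<^sup>k\<close> lies in \<open>D\<close> iff \<open>a\<^sup>k = \<plusminus>1\<close>. Modulo a prime this means
\<open>(a\<^sup>2)\<^sup>k = 1\<close> (lemma \<open>ord_square_dvd_iff\<close>), that is, \<open>k\<close> is a multiple of \<open>m = ord(a\<^sup>2) = N - 1\<close>.
From here on the argument is pure group theory, carried out in the locale \<open>normalizing_element\<close>: if
\<open>x\<close> normalizes a subgroup \<open>D\<close> and \<open>x\<^sup>k \<in> D\<close> holds exactly for the multiples \<open>k\<close> of \<open>m\<close>, then the powers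
\<open>C\<^sup>i = x\<^sup>i D\<close> of the coset \<open>C = x D\<close> are the elements of a cyclic quotient group of order \<open>m\<close>. Closure
under \<open>i\<close>-ary products means \<open>x\<^sup>i D = x D\<close>, that is, \<open>m\<close> divides \<open>i - 1\<close>; and the union of the cosets
\<open>x D, \<dots>, x\<^sup>m D\<close> is the subgroup generated by \<open>x\<close> and \<open>D\<close>.\<close>

section \<open>Powers of a coset of a normalized subgroup\<close>

text \<open>In what follows \<open><#\<close> only denotes left cosets; dropping the multiset order of the same
name keeps \<open>x <# D\<close> unambiguous.\<close>

no_notation subset_mset  (infix \<open><#\<close> 50)

lemma set_power_0: "set_power G C 0 = {\<one>\<^bsub>G\<^esub>}"
  by (auto simp: set_power_def)

lemma set_power_Suc: "set_power G C (Suc i) = C <#>\<^bsub>G\<^esub> set_power G C i"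
proof (intro equalityI subsetI)
  fix y assume "y \<in> set_power G C (Suc i)"
  then obtain xs where xs: "length xs = Suc i" "set xs \<subseteq> C"
      "y = foldr (\<lambda>x y. x \<otimes>\<^bsub>G\<^esub> y) xs \<one>\<^bsub>G\<^esub>"
    by (auto simp: set_power_def)
  then show "y \<in> C <#>\<^bsub>G\<^esub> set_power G C i"
    by (cases xs) (auto simp: set_power_def set_mult_def)
next
  fix y assume "y \<in> C <#>\<^bsub>G\<^esub> set_power G C i"
  then obtain c xs where "c \<in> C" "length xs = i" "set xs \<subseteq> C"
      "y = c \<otimes>\<^bsub>G\<^esub> foldr (\<lambda>x y. x \<otimes>\<^bsub>G\<^esub> y) xs \<one>\<^bsub>G\<^esub>"
    by (auto simp: set_power_def set_mult_def)
  then have "length (c # xs) = Suc i \<and> set (c # xs) \<subseteq> C \<and>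
      y = foldr (\<lambda>x y. x \<otimes>\<^bsub>G\<^esub> y) (c # xs) \<one>\<^bsub>G\<^esub>"
    by simp
  then show "y \<in> set_power G C (Suc i)"
    unfolding set_power_def by blast
qed

text \<open>The setting of the group-theoretic half: \<open>x\<close> normalizes \<open>D\<close>, and the powers of \<open>x\<close> that fall
into \<open>D\<close> are exactly those whose exponent is a multiple of \<open>m\<close>, so that \<open>m\<close> is the order of the
coset of \<open>x\<close> in the quotient \<open>\<langle>x, D\<rangle> / D\<close>. Since \<open>m\<close> is positive, inverses of powers of
\<open>x\<close> are again, up to \<open>D\<close>, powers with natural exponents.\<close>

locale normalizing_element = group G for G (structure) +
  fixes D :: "'a set" and x :: 'a and m :: nat
  assumes D_subgroup: "subgroup D G"
    and x_closed [simp]: "x \<in> carrier G"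
    and x_normalizes: "x <# D = D #> x"
    and m_pos: "m > 0"
    and pow_in_D_iff: "x [^] (k::nat) \<in> D \<longleftrightarrow> m dvd k"
begin

lemma D_subset [simp]: "D \<subseteq> carrier G"
  using D_subgroup by (rule subgroup.subset)

lemma pow_normalizes: "x [^] (k::nat) <# D = D #> x [^] k"
proof (induction k)
  case 0
  then show ?case by (simp add: lcos_mult_one)
next
  case (Suc k)
  have "x [^] Suc k <# D = x [^] k <# (x <# D)"
    by (simp add: lcos_m_assoc)
  also have "\<dots> = (x [^] k <# D) #> x"
    by (simp add: x_normalizes rcos_assoc_lcos)
       (auto simp: l_coset_def r_coset_def m_assoc subsetD[OF D_subset])
  also have "\<dots> = D #> x [^] Suc k"
    by (simp add: Suc coset_mult_assoc)
  finally show ?case .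
qed

lemma pow_mem_coset: "x [^] (k::nat) \<in> x [^] k <# D"
  using subgroup.one_closed[OF D_subgroup] by (force simp: l_coset_def)

lemma coset_closed: "y \<in> x [^] (k::nat) <# D \<Longrightarrow> y \<in> carrier G"
  using l_coset_subset_G[OF D_subset, of "x [^] k"] by auto

text \<open>Two-sided coset arithmetic: an element of \<open>x\<^sup>k D\<close> represents that set both as a left and as a right
coset, which is what makes \<open>D\<close> normal among all elements of such cosets.\<close>

lemma left_coset_eq:
  assumes "y \<in> x [^] (k::nat) <# D"
  shows "y <# D = x [^] k <# D"
  using l_repr_independence[OF assms _ D_subgroup] by simp

lemma right_coset_eq:
  assumes "y \<in> x [^] (k::nat) <# D"
  shows "D #> y = x [^] k <# D"
  using repr_independence[of y D "x [^] k"] assms D_subgroup by (simp add: pow_normalizes)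

lemma coset_mult:
  "(x [^] (i::nat) <# D) <#> (x [^] (j::nat) <# D) = x [^] (i + j) <# D"
proof -
  have "(x [^] i <# D) <#> (x [^] j <# D) = x [^] i <# (D <#> (x [^] j <# D))"
    by (simp add: setmult_lcos_assoc l_coset_subset_G l_coset_eq_set_mult set_mult_assoc set_mult_closed)
  also have "D <#> (x [^] j <# D) = D <#> D #> x [^] j"
    by (simp add: pow_normalizes setmult_rcos_assoc)
  also have "\<dots> = x [^] j <# D"
    by (simp add: subgroup_mult_id[OF D_subgroup] pow_normalizes)
  also have "x [^] i <# (x [^] j <# D) = x [^] (i + j) <# D"
    by (simp add: lcos_m_assoc nat_pow_mult)
  finally show ?thesis .
qed

text \<open>The dictionary between cosets and arithmetic: cancelling \<open>x\<^sup>i\<close> turns the question whether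
\<open>x\<^sup>i\<^sup>+\<^sup>j\<close> represents the coset \<open>x\<^sup>i D\<close> into divisibility of \<open>j\<close> by \<open>m\<close>.\<close>

lemma pow_mem_coset_iff: "x [^] (i + j :: nat) \<in> x [^] i <# D \<longleftrightarrow> m dvd j"
proof
  assume "x [^] (i + j) \<in> x [^] i <# D"
  then obtain d where d: "d \<in> D" "x [^] (i + j) = x [^] i \<otimes> d"
    by (auto simp: l_coset_def)
  then have "x [^] i \<otimes> x [^] j = x [^] i \<otimes> d"
    by (simp add: nat_pow_mult)
  moreover have "d \<in> carrier G"
    using d D_subset by blast
  ultimately have "x [^] j \<in> D"
    using d by simp
  then show "m dvd j"
    by (simp add: pow_in_D_iff)
next
  assume "m dvd j"
  then show "x [^] (i + j) \<in> x [^] i <# D"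
    by (auto simp: l_coset_def pow_in_D_iff simp flip: nat_pow_mult)
qed

lemma coset_eq_add:
  assumes "m dvd j"
  shows "x [^] (i + j) <# D = x [^] i <# D"
  using assms left_coset_eq pow_mem_coset_iff by blast

lemma coset_eq_mod:
  shows "x [^] (k mod m) <# D = x [^] k <# D"
  using coset_eq_add[of "m * (k div m)" "k mod m"] by simp

text \<open>As \<open>x\<^sup>k\<^sup>m \<in> D\<close>, the exponent \<open>k (m - 1)\<close> stands in for the exponent \<open>-k\<close>.\<close>

lemma inv_mem_coset:
  assumes "y \<in> x [^] (k::nat) <# D"
  shows "inv y \<in> x [^] (k * (m - 1)) <# D"
proof -
  let ?l = "k * (m - 1)"
  have "k + ?l = k * m"
    using m_pos by (cases m) auto
  then have pD: "x [^] (k + ?l) \<in> D"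
    by (simp add: pow_in_D_iff)
  have "y \<in> D #> x [^] k"
    using assms by (simp add: pow_normalizes)
  then obtain d where d: "d \<in> D" "y = d \<otimes> x [^] k"
    by (auto simp: r_coset_def)
  have dG: "d \<in> carrier G"
    using d D_subset by blast
  have "y \<otimes> x [^] ?l = d \<otimes> x [^] (k + ?l)"
    using dG by (simp add: d m_assoc nat_pow_mult)
  also have "\<dots> \<in> D"
    using d pD D_subgroup by (simp add: subgroup.m_closed)
  finally have "inv (y \<otimes> x [^] ?l) \<in> D"
    using D_subgroup by (simp add: subgroup.m_inv_closed)
  moreover have "inv y = x [^] ?l \<otimes> inv (y \<otimes> x [^] ?l)"
    using coset_closed[OF assms] by (simp add: inv_mult_group flip: m_assoc)
  ultimately show ?thesis
    by (auto simp: l_coset_def)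
qed

text \<open>Products of \<open>i\<close> elements of \<open>x D\<close> fill out \<open>x\<^sup>i D\<close>, since coset multiplication adds exponents. The
case \<open>i = 0\<close> is excluded because the empty product gives \<open>{\<one>}\<close> instead of \<open>D\<close>.\<close>

lemma set_power_coset:
  assumes "i \<ge> 1"
  shows "set_power G (x <# D) i = x [^] i <# D"
  using assms
proof (induction i rule: dec_induct)
  case base
  have "x <# D <#> {\<one>} = x <# D"
    using coset_mult_one[OF l_coset_subset_G[OF D_subset x_closed]]
    by (simp add: r_coset_eq_set_mult)
  then show ?case
    by (simp add: set_power_Suc set_power_0)
next
  case (step i)
  then show ?case
    using coset_mult[of 1 i] by (simp add: set_power_Suc)
qed

text \<open>Closure under \<open>i\<close>-ary products means \<open>x\<^sup>i D \<subseteq> x D\<close>, hence \<open>x\<^sup>i\<^sup>-\<^sup>1 \<in> D\<close>. The smallest arity \<open>i \<ge> 2\<close> of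
this kind is therefore \<open>m + 1\<close>.\<close>

lemma closed_nary_coset_iff:
  assumes "i \<ge> 1"
  shows "closed_nary G (x <# D) i \<longleftrightarrow> m dvd i - 1"
proof -
  have "closed_nary G (x <# D) i \<longleftrightarrow> x [^] i <# D \<subseteq> x [^] (1::nat) <# D"
    using assms by (simp add: closed_nary_def set_power_coset)
  also have "\<dots> \<longleftrightarrow> x [^] i \<in> x [^] (1::nat) <# D"
    using pow_mem_coset left_coset_eq by blast
  also have "\<dots> \<longleftrightarrow> m dvd i - 1"
    using pow_mem_coset_iff[of 1 "i - 1"] assms by simp
  finally show ?thesis .
qed

theorem strictly_nary_coset: "strictly_nary G (x <# D) (m + 1)"
  using m_pos by (auto simp: strictly_nary_def closed_nary_coset_iff dest: dvd_imp_le)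

lemma subgroup_cosets: "subgroup (\<Union>k::nat. x [^] k <# D) G"
proof (rule subgroupI)
  show "(\<Union>k::nat. x [^] k <# D) \<subseteq> carrier G"
    using coset_closed by blast
  show "(\<Union>k::nat. x [^] k <# D) \<noteq> {}"
    using pow_mem_coset by blast
next
  fix y assume "y \<in> (\<Union>k::nat. x [^] k <# D)"
  then show "inv y \<in> (\<Union>k::nat. x [^] k <# D)"
    using inv_mem_coset by blast
next
  fix y z assume "y \<in> (\<Union>k::nat. x [^] k <# D)" "z \<in> (\<Union>k::nat. x [^] k <# D)"
  then show "y \<otimes> z \<in> (\<Union>k::nat. x [^] k <# D)"
    using coset_mult by (fastforce simp: set_mult_def)
qed

lemma generate_eq_cosets: "generate G (insert x D) = (\<Union>k::nat. x [^] k <# D)"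
proof (rule generateI[OF subgroup_cosets, symmetric])
  have "D \<subseteq> x [^] (0::nat) <# D" and "x \<in> x [^] (1::nat) <# D"
    using pow_mem_coset[of 1] by (simp_all add: lcos_mult_one)
  then show "insert x D \<subseteq> (\<Union>k::nat. x [^] k <# D)"
    by blast
next
  fix K assume K: "subgroup K G" "insert x D \<subseteq> K"
  have "x [^] k \<in> K" for k :: nat
    by (induction k) (use K in \<open>auto intro: subgroup.one_closed subgroup.m_closed\<close>)
  then show "(\<Union>k::nat. x [^] k <# D) \<subseteq> K"
    using K by (auto simp: l_coset_def intro!: subgroup.m_closed)
qed

text \<open>The exponents \<open>1, \<dots>, m\<close> represent all residues modulo \<open>m\<close>. Exponent \<open>m\<close> takes the place of \<open>0\<close>,
because the empty power of \<open>x D\<close> is \<open>{\<one>}\<close>, whereas its \<open>m\<close>-th power is \<open>D\<close>.\<close>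

theorem generate_eq_Union_set_power:
  "generate G (insert x D) = (\<Union>i\<in>{1..m}. set_power G (x <# D) i)"
proof -
  have "\<exists>i\<in>{1..m}. x [^] k <# D = x [^] i <# D" for k :: nat
  proof (cases "m dvd k")
    case True
    then show ?thesis
      using m_pos coset_eq_add[of k 0] coset_eq_add[of m 0] by force
  next
    case False
    then have "k mod m \<in> {1..m}"
      using m_pos by (auto simp: Suc_le_eq mod_greater_zero_iff_not_dvd)
    then show ?thesis
      using coset_eq_mod[of k] by blast
  qed
  then have "(\<Union>k::nat. x [^] k <# D) = (\<Union>i\<in>{1..m}. x [^] i <# D)"
    by blast
  then show ?thesis
    by (simp add: generate_eq_cosets set_power_coset)
qed

theorem normal_in_generate: "D \<lhd> G\<lparr>carrier := generate G (insert x D)\<rparr>"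
proof (rule group.normalI)
  let ?H = "generate G (insert x D)"
  show "group (G\<lparr>carrier := ?H\<rparr>)"
    by (rule subgroup.subgroup_is_group[OF generate_is_subgroup]) (use is_group in auto)
  have "D \<subseteq> ?H"
    by (auto intro: generate.incl)
  then show "subgroup D (G\<lparr>carrier := ?H\<rparr>)"
    by (intro subgroup_incl D_subgroup generate_is_subgroup) auto
  show "\<forall>y\<in>carrier (G\<lparr>carrier := ?H\<rparr>). D #>\<^bsub>G\<lparr>carrier := ?H\<rparr>\<^esub> y = y <#\<^bsub>G\<lparr>carrier := ?H\<rparr>\<^esub> D"
    using left_coset_eq right_coset_eq by (auto simp: generate_eq_cosets)
qed

theorem generate_Mod_iso:
  "(G\<lparr>carrier := generate G (insert x D)\<rparr>) Mod D \<cong> integer_mod_group m"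
proof -
  let ?Q = "(G\<lparr>carrier := generate G (insert x D)\<rparr>) Mod D"
  \<comment> \<open>The coset \<open>x\<^sup>k D\<close> depends on \<open>k\<close> modulo \<open>m\<close> only, and distinct residues give distinct cosets.\<close>
  let ?h = "\<lambda>k::int. x [^] nat k <# D"
  have carrier_Q: "carrier ?Q = range (\<lambda>k::nat. x [^] k <# D)"
  proof (intro equalityI subsetI)
    fix K assume "K \<in> carrier ?Q"
    then obtain y k where "y \<in> x [^] (k::nat) <# D" "K = D #> y"
      by (auto simp: carrier_FactGroup generate_eq_cosets)
    then show "K \<in> range (\<lambda>k::nat. x [^] k <# D)"
      using right_coset_eq by blast
  next
    fix K assume "K \<in> range (\<lambda>k::nat. x [^] k <# D)"
    then obtain k :: nat where "K = D #> x [^] k"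
      by (auto simp: pow_normalizes)
    then show "K \<in> carrier ?Q"
      using pow_mem_coset by (auto simp: carrier_FactGroup generate_eq_cosets)
  qed
  have carrier_Z: "carrier (integer_mod_group m) = {0..<int m}"
    using m_pos by (simp add: carrier_integer_mod_group)
  have "?h \<in> iso (integer_mod_group m) ?Q"
  proof (rule isoI)
    show "?h \<in> hom (integer_mod_group m) ?Q"
    proof (rule homI)
      fix i j assume "i \<in> carrier (integer_mod_group m)" "j \<in> carrier (integer_mod_group m)"
      then have "nat ((i + j) mod int m) = (nat i + nat j) mod m"
        by (simp add: carrier_Z nat_mod_distrib nat_add_distrib)
      then show "?h (i \<otimes>\<^bsub>integer_mod_group m\<^esub> j) = ?h i \<otimes>\<^bsub>?Q\<^esub> ?h j"
        by (simp add: coset_eq_mod coset_mult)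
    qed (auto simp: carrier_Q)
    have "inj_on ?h {0..<int m}"
    proof (rule linorder_inj_onI)
      fix i j assume ij: "i < j" "i \<in> {0..<int m}" "j \<in> {0..<int m}"
      then have "\<not> m dvd nat j - nat i"
        by (auto dest!: dvd_imp_le)
      moreover have "nat j = nat i + (nat j - nat i)"
        using ij by simp
      ultimately have "x [^] nat j \<notin> x [^] nat i <# D"
        using pow_mem_coset_iff by metis
      then show "?h i \<noteq> ?h j"
        using pow_mem_coset by metis
    qed auto
    moreover have "?h ` {0..<int m} = range (\<lambda>k::nat. x [^] k <# D)"
    proof (intro equalityI subsetI)
      fix K assume "K \<in> range (\<lambda>k::nat. x [^] k <# D)"
      then obtain k :: nat where "K = ?h (int (k mod m))"
        using coset_eq_mod by auto
      moreover have "int (k mod m) \<in> {0..<int m}"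
        using m_pos by simp
      ultimately show "K \<in> ?h ` {0..<int m}"
        by blast
    qed blast
    ultimately show "bij_betw ?h (carrier (integer_mod_group m)) (carrier ?Q)"
      by (simp add: bij_betw_def carrier_Z carrier_Q)
  qed
  then show ?thesis
    using group.iso_sym[OF group_integer_mod_group] by (auto simp: is_iso_def)
qed

end

section \<open>Affine permutations of the residues\<close>

lemma residue_rep_eq_iff:
  assumes "n \<ge> 1"
  shows "residue_rep n k = residue_rep n l \<longleftrightarrow> [k = l] (mod int n)"
proof
  assume "residue_rep n k = residue_rep n l"
  then show "[k = l] (mod int n)"
    using residue_rep_cong[OF assms, of k] residue_rep_cong[OF assms, of l]
    by (metis cong_sym cong_trans)
next
  assume "[k = l] (mod int n)"
  then have "[k - 1 = l - 1] (mod int n)"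
    by (simp add: cong_diff)
  then show "residue_rep n k = residue_rep n l"
    by (simp add: residue_rep_def cong_def)
qed

lemma residue_rep_of_nat:
  assumes "i \<in> {1..n}"
  shows "residue_rep n (int i) = i"
  using assms by (auto simp: residue_rep_def)

text \<open>The map \<open>i \<mapsto> u i + b\<close> of residues modulo \<open>n\<close>, transported to \<open>{1..n}\<close>. Multiplications, rotations
and the flip are all of this form, so that products in the symmetric group reduce to arithmetic
with the pairs \<open>(u, b)\<close>.\<close>

definition affine_perm :: "nat \<Rightarrow> int \<Rightarrow> int \<Rightarrow> nat \<Rightarrow> nat" where
  "affine_perm n u b i = (if i \<in> {1..n} then residue_rep n (u * int i + b) else i)"

lemma affine_perm_in:
  assumes "i \<in> {1..n}"
  shows "affine_perm n u b i \<in> {1..n}"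
proof -
  have "n \<ge> 1" using assms by simp
  then show ?thesis using assms by (simp only: affine_perm_def if_True residue_rep_in)
qed

lemma affine_perm_residue:
  assumes "i \<in> {1..n}"
  shows "[int (affine_perm n u b i) = u * int i + b] (mod int n)"
  using assms by (auto simp: affine_perm_def intro: residue_rep_cong)

lemma affine_perm_comp:
  "affine_perm n u b \<circ> affine_perm n v c = affine_perm n (u * v) (u * c + b)"
proof
  fix i
  show "(affine_perm n u b \<circ> affine_perm n v c) i = affine_perm n (u * v) (u * c + b) i"
  proof (cases "i \<in> {1..n}")
    case True
    then have n: "n \<ge> 1" by simp
    have "[u * int (affine_perm n v c i) + b = u * (v * int i + c) + b] (mod int n)"
      by (intro cong_add cong_mult affine_perm_residue True) auto
    then have "[u * int (affine_perm n v c i) + b = u * v * int i + (u * c + b)] (mod int n)"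
      by (simp add: algebra_simps)
    then have "residue_rep n (u * int (affine_perm n v c i) + b)
        = residue_rep n (u * v * int i + (u * c + b))"
      using n by (simp add: residue_rep_eq_iff)
    moreover have "affine_perm n u b j = residue_rep n (u * int j + b)" if "j \<in> {1..n}" for j b u
      using that by (simp only: affine_perm_def if_True)
    ultimately show ?thesis
      using affine_perm_in[OF True] True by (simp only: comp_apply)
  qed (auto simp: affine_perm_def)
qed

lemma affine_perm_eq_iff:
  assumes "n \<ge> 1"
  shows "affine_perm n u b = affine_perm n v c \<longleftrightarrow> [u = v] (mod int n) \<and> [b = c] (mod int n)"
proof
  assume eq: "affine_perm n u b = affine_perm n v c"
  have *: "[u * int i + b = v * int i + c] (mod int n)" if "i \<in> {1..n}" for i
    using affine_perm_residue[OF that, of u b] affine_perm_residue[OF that, of v c] eq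
    by (metis cong_sym cong_trans)
  \<comment> \<open>The representative \<open>n\<close> of the residue 0 isolates the constant term; the residue 1 then gives the slope.\<close>
  have "[u * int n + b = v * int n + c] (mod int n)"
    using * assms by simp
  then have b: "[b = c] (mod int n)"
    by (simp add: cong_def)
  moreover have "[u + b = v + c] (mod int n)"
    using *[of 1] assms by simp
  then have "[u + b - b = v + c - c] (mod int n)"
    using b by (intro cong_diff)
  ultimately show "[u = v] (mod int n) \<and> [b = c] (mod int n)"
    by simp
next
  assume "[u = v] (mod int n) \<and> [b = c] (mod int n)"
  then have "[u * int i + b = v * int i + c] (mod int n)" for i
    by (intro cong_add cong_mult) auto
  then have "residue_rep n (u * int i + b) = residue_rep n (v * int i + c)" for i
    using assms by (simp add: residue_rep_eq_iff)
  then show "affine_perm n u b = affine_perm n v c"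
    unfolding affine_perm_def by presburger
qed

lemma affine_perm_id: "affine_perm n 1 0 = id"
proof
  fix i show "affine_perm n 1 0 i = id i"
    using residue_rep_of_nat[of i n] by (simp add: affine_perm_def)
qed

lemma affine_perm_permutes:
  assumes "coprime u (int n)"
  shows "affine_perm n u b permutes {1..n}"
proof (rule bij_imp_permutes)
  have "inj_on (affine_perm n u b) {1..n}"
  proof (rule inj_onI)
    fix i j assume ij: "i \<in> {1..n}" "j \<in> {1..n}" "affine_perm n u b i = affine_perm n u b j"
    then have "[u * int i + b = u * int j + b] (mod int n)"
      using affine_perm_residue by (metis cong_sym cong_trans)
    then have "[u * int i = u * int j] (mod int n)"
      by (simp add: cong_add_rcancel)
    then have "[int i = int j] (mod int n)"
      using assms by (simp add: cong_mult_lcancel)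
    then have "residue_rep n (int i) = residue_rep n (int j)"
      using ij by (subst residue_rep_eq_iff) auto
    then show "i = j"
      using ij by (simp only: residue_rep_of_nat)
  qed
  moreover have "affine_perm n u b ` {1..n} \<subseteq> {1..n}"
    using affine_perm_in by blast
  ultimately show "bij_betw (affine_perm n u b) {1..n} {1..n}"
    by (simp add: bij_betw_def endo_inj_surj)
next
  fix i assume "i \<notin> {1..n}"
  then show "affine_perm n u b i = i" by (simp only: affine_perm_def if_False)
qed

section \<open>The dihedral group and its multiplier cosets\<close>

lemma flip_eq_affine: "flip n = affine_perm n (- 1) 1"
proof
  fix i show "flip n i = affine_perm n (- 1) 1 i"
  proof (cases "i \<in> {1..n}")
    case True
    then have n: "n \<ge> 1" and j: "n + 1 - i \<in> {1..n}" by auto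
    have "[int (n + 1 - i) = - 1 * int i + 1] (mod int n)"
      using True by (simp add: of_nat_diff cong_iff_dvd_diff)
    then have "residue_rep n (- 1 * int i + 1) = residue_rep n (int (n + 1 - i))"
      using n by (metis residue_rep_eq_iff)
    then show ?thesis
      using True residue_rep_of_nat[OF j] by (simp add: flip_def affine_perm_def)
  next
    case False
    then show ?thesis by (simp only: flip_def affine_perm_def if_False)
  qed
qed

lemma cyc_shift_eq_affine: "cyc_shift n = affine_perm n 1 1"
  by (simp add: fun_eq_iff cyc_shift_def affine_perm_def)

lemma mult_perm_eq_affine: "mult_perm n a = affine_perm n a 0"
  by (simp add: fun_eq_iff mult_perm_def affine_perm_def)

lemma mult_perm_pow:
  "mult_perm n a [^]\<^bsub>sym_group n\<^esub> (k::nat) = affine_perm n (a ^ k) 0"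
proof (induction k)
  case 0
  then show ?case by (simp add: sym_group_one affine_perm_id)
next
  case (Suc k)
  then show ?case
    by (simp add: sym_group_mult mult_perm_eq_affine affine_perm_comp mult.commute)
qed

lemma cyc_shift_pow:
  "cyc_shift n [^]\<^bsub>sym_group n\<^esub> (k::nat) = affine_perm n 1 (int k)"
proof (induction k)
  case 0
  then show ?case by (simp add: sym_group_one affine_perm_id)
next
  case (Suc k)
  then show ?case
    by (simp add: sym_group_mult cyc_shift_eq_affine affine_perm_comp add.commute)
qed

lemma affine_in_sym_group: "coprime u (int n) \<Longrightarrow> affine_perm n u b \<in> carrier (sym_group n)"
  unfolding sym_group_carrier by (rule affine_perm_permutes)

lemma dihedral_subgroup: "subgroup (dihedral n) (sym_group n)"
  unfolding dihedral_def
  by (rule group.generate_is_subgroup[OF sym_group_is_group])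
     (auto simp: flip_eq_affine cyc_shift_eq_affine intro!: affine_in_sym_group)

text \<open>The affine maps of slope \<open>\<plusminus>1\<close> are closed under composition and contain both generators; conversely,
every such map is a rotation, possibly preceded by the flip.\<close>

lemma dihedral_eq:
  assumes n: "n \<ge> 1"
  shows "dihedral n = {affine_perm n u b | u b. u \<in> {1, -1}}" (is "_ = ?A")
proof
  interpret group "sym_group n" by (rule sym_group_is_group)
  have in_carrier: "affine_perm n u b \<in> carrier (sym_group n)" if "u \<in> {1, -1}" for u b
    using that by (auto intro!: affine_in_sym_group)
  have "subgroup ?A (sym_group n)"
  proof (rule subgroupI)
    show "?A \<subseteq> carrier (sym_group n)"
      using in_carrier by blast
    fix \<sigma> assume "\<sigma> \<in> ?A"
    then obtain u b where ub: "u \<in> {1, -1}" "\<sigma> = affine_perm n u b" by blast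
    then have "affine_perm n u (- (u * b)) \<otimes>\<^bsub>sym_group n\<^esub> \<sigma> = \<one>\<^bsub>sym_group n\<^esub>"
      by (auto simp: sym_group_mult sym_group_one affine_perm_comp affine_perm_id)
    then have "inv\<^bsub>sym_group n\<^esub> \<sigma> = affine_perm n u (- (u * b))"
      using in_carrier ub by (intro inv_equality) auto
    then show "inv\<^bsub>sym_group n\<^esub> \<sigma> \<in> ?A"
      using ub by blast
    fix \<tau> assume "\<tau> \<in> ?A"
    then obtain v c where vc: "v \<in> {1, -1}" "\<tau> = affine_perm n v c" by blast
    then have "\<sigma> \<otimes>\<^bsub>sym_group n\<^esub> \<tau> = affine_perm n (u * v) (u * c + b)"
      by (simp add: ub sym_group_mult affine_perm_comp)
    moreover have "u * v \<in> {1, -1}" using ub vc by auto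
    ultimately show "\<sigma> \<otimes>\<^bsub>sym_group n\<^esub> \<tau> \<in> ?A" by blast
  qed auto
  then show "dihedral n \<subseteq> ?A"
    unfolding dihedral_def flip_eq_affine cyc_shift_eq_affine
    by (rule generate_subgroup_incl[rotated]) blast
next
  interpret group "sym_group n" by (rule sym_group_is_group)
  interpret D: subgroup "dihedral n" "sym_group n" by (rule dihedral_subgroup)
  have gens: "flip n \<in> dihedral n" "cyc_shift n \<in> dihedral n"
    by (auto simp: dihedral_def intro: generate.incl)
  have rot_pow: "cyc_shift n [^]\<^bsub>sym_group n\<^esub> (k::nat) \<in> dihedral n" for k
    by (induction k) (use gens in \<open>simp_all add: D.one_closed D.m_closed\<close>)
  have rot: "affine_perm n 1 b \<in> dihedral n" for b
  proof -
    have "affine_perm n 1 b = affine_perm n 1 (int (nat (b mod int n)))"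
      using n by (simp add: affine_perm_eq_iff cong_def)
    also have "\<dots> = cyc_shift n [^]\<^bsub>sym_group n\<^esub> nat (b mod int n)"
      by (simp add: cyc_shift_pow)
    finally show ?thesis
      using rot_pow by simp
  qed
  have "affine_perm n (-1) b = affine_perm n 1 (b - 1) \<otimes>\<^bsub>sym_group n\<^esub> flip n" for b
    by (simp add: sym_group_mult flip_eq_affine affine_perm_comp)
  then have "affine_perm n (-1) b \<in> dihedral n" for b
    using rot gens by simp
  then show "?A \<subseteq> dihedral n"
    using rot by auto
qed

lemma affine_in_dihedral_iff:
  assumes "n \<ge> 1"
  shows "affine_perm n u b \<in> dihedral n \<longleftrightarrow> [u = 1] (mod int n) \<or> [u = - 1] (mod int n)"
proof -
  have "affine_perm n u b \<in> dihedral n \<longleftrightarrow>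
      (\<exists>v\<in>{1, -1}. \<exists>c. affine_perm n u b = affine_perm n v c)"
    unfolding dihedral_eq[OF assms] by blast
  also have "\<dots> \<longleftrightarrow> (\<exists>v\<in>{1, -1}. [u = v] (mod int n))"
    using cong_refl[of b "int n"] by (auto simp only: affine_perm_eq_iff[OF assms])
  finally show ?thesis by simp
qed

text \<open>Left multiplication by \<open>\<pi>\<^sub>a\<close> turns the map \<open>i \<mapsto> \<plusminus>i + b\<close> into \<open>i \<mapsto> \<plusminus>a i + a b\<close>, while right
multiplication gives \<open>i \<mapsto> \<plusminus>a i + b\<close>. As \<open>a\<close> is a unit, \<open>a b\<close> runs through all residues with \<open>b\<close>, so
both cosets consist of all affine maps of slope \<open>\<plusminus>a\<close>.\<close>

lemma mult_perm_lcoset_dihedral: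
  assumes n: "n \<ge> 1" and a: "coprime a (int n)"
  shows "mult_perm n a <#\<^bsub>sym_group n\<^esub> dihedral n = {affine_perm n (a * u) b | u b. u \<in> {1, -1}}"
    (is "_ = ?A")
proof (intro equalityI subsetI)
  fix \<sigma> assume "\<sigma> \<in> ?A"
  then obtain u b where ub: "u \<in> {1, -1}" "\<sigma> = affine_perm n (a * u) b" by blast
  obtain a' where a': "[a * a' = 1] (mod int n)"
    using a cong_solve_coprime_int by blast
  have "mult_perm n a \<otimes>\<^bsub>sym_group n\<^esub> affine_perm n u (a' * b) = affine_perm n (a * u) (a * a' * b)"
    by (simp add: sym_group_mult mult_perm_eq_affine affine_perm_comp mult.assoc)
  also have "\<dots> = \<sigma>"
    using cong_mult[OF a' cong_refl[of b]] n by (simp add: ub affine_perm_eq_iff)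
  finally have "\<sigma> = mult_perm n a \<otimes>\<^bsub>sym_group n\<^esub> affine_perm n u (a' * b)" by simp
  moreover have "affine_perm n u (a' * b) \<in> dihedral n"
    using ub(1) unfolding dihedral_eq[OF n] by blast
  ultimately show "\<sigma> \<in> mult_perm n a <#\<^bsub>sym_group n\<^esub> dihedral n"
    unfolding l_coset_def by blast
next
  fix \<sigma> assume "\<sigma> \<in> mult_perm n a <#\<^bsub>sym_group n\<^esub> dihedral n"
  then obtain u b where "u \<in> {1, -1}" "\<sigma> = mult_perm n a \<otimes>\<^bsub>sym_group n\<^esub> affine_perm n u b"
    unfolding l_coset_def dihedral_eq[OF n] by blast
  moreover have "mult_perm n a \<otimes>\<^bsub>sym_group n\<^esub> affine_perm n u b = affine_perm n (a * u) (a * b)" for u b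
    by (simp add: sym_group_mult mult_perm_eq_affine affine_perm_comp)
  ultimately show "\<sigma> \<in> ?A" by auto
qed

lemma mult_perm_rcoset_dihedral:
  assumes n: "n \<ge> 1"
  shows "dihedral n #>\<^bsub>sym_group n\<^esub> mult_perm n a = {affine_perm n (a * u) b | u b. u \<in> {1, -1}}"
proof -
  have "affine_perm n u b \<otimes>\<^bsub>sym_group n\<^esub> mult_perm n a = affine_perm n (a * u) b" for u b
    by (simp add: sym_group_mult mult_perm_eq_affine affine_perm_comp mult.commute)
  moreover have "dihedral n #>\<^bsub>sym_group n\<^esub> mult_perm n a
      = {affine_perm n u b \<otimes>\<^bsub>sym_group n\<^esub> mult_perm n a | u b. u \<in> {1, -1}}"
    unfolding r_coset_def dihedral_eq[OF n] by blast
  ultimately show ?thesis by presburger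
qed

section \<open>Panmagic affine permutations\<close>

lemma sum_perm_matrix_eq_card:
  assumes "\<sigma> permutes {1..n}"
  shows "sum (perm_matrix \<sigma>) {(i, j) \<in> {1..n} \<times> {1..n}. P i j} = int (card {j \<in> {1..n}. P (\<sigma> j) j})"
proof -
  let ?S = "{(i, j) \<in> {1..n} \<times> {1..n}. P i j}"
  have fin: "finite ?S"
    by (rule finite_subset[of _ "{1..n} \<times> {1..n}"]) auto
  have "sum (perm_matrix \<sigma>) ?S = (\<Sum>q\<in>?S. if fst q = \<sigma> (snd q) then 1 else 0)"
    by (intro sum.cong) (auto simp: perm_matrix_def)
  also have "\<dots> = int (card {q \<in> ?S. fst q = \<sigma> (snd q)})"
    using fin by (simp add: sum.If_cases Int_def)
  also have "{q \<in> ?S. fst q = \<sigma> (snd q)} = (\<lambda>j. (\<sigma> j, j)) ` {j \<in> {1..n}. P (\<sigma> j) j}"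
  proof (intro equalityI subsetI)
    fix q assume "q \<in> (\<lambda>j. (\<sigma> j, j)) ` {j \<in> {1..n}. P (\<sigma> j) j}"
    then obtain j where j: "q = (\<sigma> j, j)" "j \<in> {1..n}" "P (\<sigma> j) j" by blast
    moreover have "\<sigma> j \<in> {1..n}"
      using permutes_in_image[OF assms] j(2) by blast
    ultimately show "q \<in> {q \<in> ?S. fst q = \<sigma> (snd q)}" by simp
  qed force
  also have "card \<dots> = card {j \<in> {1..n}. P (\<sigma> j) j}"
    by (intro card_image inj_onI) simp
  finally show ?thesis .
qed

lemma card_affine_fibre:
  assumes "n \<ge> 1" "coprime v (int n)"
  shows "card {j \<in> {1..n}. [v * int j + b = c] (mod int n)} = 1"
proof -
  let ?f = "affine_perm n v b"
  have perm: "?f permutes {1..n}"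
    using assms(2) by (rule affine_perm_permutes)
  have "[v * int j + b = c] (mod int n) \<longleftrightarrow> ?f j = residue_rep n c" if "j \<in> {1..n}" for j
    using that assms(1) by (simp add: affine_perm_def residue_rep_eq_iff)
  then have "{j \<in> {1..n}. [v * int j + b = c] (mod int n)} = {j \<in> {1..n}. ?f j = residue_rep n c}"
    by blast
  also have "\<dots> = {Hilbert_Choice.inv ?f (residue_rep n c)}"
  proof -
    have "Hilbert_Choice.inv ?f (residue_rep n c) \<in> {1..n}"
      using permutes_in_image[OF permutes_inv[OF perm]] residue_rep_in[OF assms(1)] by blast
    moreover have "?f j = residue_rep n c \<longleftrightarrow> j = Hilbert_Choice.inv ?f (residue_rep n c)" for j
      using permutes_inv_eq[OF perm, of "residue_rep n c" j] by metis
    ultimately show ?thesis by blast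
  qed
  finally show ?thesis by simp
qed

text \<open>The column \<open>j\<close> contributes to the diagonal sum iff \<open>\<sigma> j - j = (u - 1) j + b\<close> is the prescribed
residue, and to the anti-diagonal sum iff \<open>\<sigma> j + j = (u + 1) j + b\<close> is. Both are affine functions of
\<open>j\<close> with unit slope, so exactly one column contributes.\<close>

lemma panmagic_affine_perm:
  assumes n: "n \<ge> 1"
    and u: "coprime u (int n)" "coprime (u + 1) (int n)" "coprime (u - 1) (int n)"
  shows "panmagic_perm n (affine_perm n u b)"
proof -
  let ?f = "affine_perm n u b"
  have perm: "?f permutes {1..n}"
    using u(1) by (rule affine_perm_permutes)
  have "sum (perm_matrix ?f) (broken_diagonal n c) = 1" for c
  proof -
    have "[int (?f j) - int j = c] (mod int n) \<longleftrightarrow> [(u - 1) * int j + b = c] (mod int n)"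
      if "j \<in> {1..n}" for j
    proof -
      have "[int (?f j) - int j = u * int j + b - int j] (mod int n)"
        by (intro cong_diff affine_perm_residue that cong_refl)
      then show ?thesis
        by (simp add: cong_def algebra_simps)
    qed
    then have "{j \<in> {1..n}. [int (?f j) - int j = c] (mod int n)}
        = {j \<in> {1..n}. [(u - 1) * int j + b = c] (mod int n)}"
      by blast
    then show ?thesis
      unfolding broken_diagonal_def sum_perm_matrix_eq_card[OF perm]
      using card_affine_fibre[OF n u(3)] by simp
  qed
  moreover have "sum (perm_matrix ?f) (broken_antidiagonal n c) = 1" for c
  proof -
    have "[int (?f j) + int j = c] (mod int n) \<longleftrightarrow> [(u + 1) * int j + b = c] (mod int n)"
      if "j \<in> {1..n}" for j
    proof -
      have "[int (?f j) + int j = u * int j + b + int j] (mod int n)"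
        by (intro cong_add affine_perm_residue that cong_refl)
      then show ?thesis
        by (simp add: cong_def algebra_simps)
    qed
    then have "{j \<in> {1..n}. [int (?f j) + int j = c] (mod int n)}
        = {j \<in> {1..n}. [(u + 1) * int j + b = c] (mod int n)}"
      by blast
    then show ?thesis
      unfolding broken_antidiagonal_def sum_perm_matrix_eq_card[OF perm]
      using card_affine_fibre[OF n u(2)] by simp
  qed
  ultimately show ?thesis
    using perm by (simp add: panmagic_perm_def)
qed

lemma panmagic_unit_coprime:
  assumes "n \<ge> 2" "panmagic_unit n a"
  shows "coprime a (int n)" "coprime (a + 1) (int n)" "coprime (a - 1) (int n)"
proof -
  interpret residues "int n" "residue_ring (int n)"
    using assms by unfold_locales auto
  have coprime_if_unit: "coprime k (int n)" if "k mod int n \<in> Units (residue_ring (int n))" for k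
    using that m_gt_one by (simp add: res_units_eq)
  have "a \<in> Units (residue_ring (int n))"
    and plus: "a \<oplus>\<^bsub>residue_ring (int n)\<^esub> \<one>\<^bsub>residue_ring (int n)\<^esub> \<in> Units (residue_ring (int n))"
    and minus: "a \<ominus>\<^bsub>residue_ring (int n)\<^esub> \<one>\<^bsub>residue_ring (int n)\<^esub> \<in> Units (residue_ring (int n))"
    using assms(2) unfolding panmagic_unit_def Let_def by blast+
  then show "coprime a (int n)"
    unfolding res_units_eq by blast
  show "coprime (a + 1) (int n)"
    using plus unfolding res_add_eq res_one_eq by (rule coprime_if_unit)
  have "a \<ominus>\<^bsub>residue_ring (int n)\<^esub> \<one>\<^bsub>residue_ring (int n)\<^esub> = (a - 1) mod int n"
    unfolding a_minus_def res_add_eq res_neg_eq res_one_eq by (simp only: mod_add_right_eq add_uminus_conv_diff)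
  then show "coprime (a - 1) (int n)"
    using minus coprime_if_unit by metis
qed

section \<open>Panmagic cosets of the dihedral group\<close>

text \<open>This is where primality is used: modulo a prime the only square roots of 1 are \<open>\<plusminus>1\<close>, so that
\<open>(a\<^sup>2)\<^sup>k = (a\<^sup>k)\<^sup>2 = 1\<close> is the same as \<open>a\<^sup>k = \<plusminus>1\<close>.\<close>

lemma ord_square_dvd_iff:
  assumes p: "prime p" and a: "a \<in> Units (residue_ring (int p))"
  shows "group.ord (units_of (residue_ring (int p))) (a \<otimes>\<^bsub>residue_ring (int p)\<^esub> a) dvd k
    \<longleftrightarrow> [a ^ k = 1] (mod int p) \<or> [a ^ k = - 1] (mod int p)"
proof -
  let ?R = "residue_ring (int p)"
  interpret residues "int p" ?R
    using prime_gt_1_nat[OF p] by unfold_locales auto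
  interpret U: group "units_of ?R" by (rule units_group)
  have aa: "a \<otimes>\<^bsub>?R\<^esub> a \<in> Units ?R"
    using a by simp
  have "group.ord (units_of ?R) (a \<otimes>\<^bsub>?R\<^esub> a) dvd k \<longleftrightarrow> (a \<otimes>\<^bsub>?R\<^esub> a) [^]\<^bsub>units_of ?R\<^esub> k = \<one>\<^bsub>units_of ?R\<^esub>"
    using U.pow_eq_id[of "a \<otimes>\<^bsub>?R\<^esub> a" k] aa by (simp add: units_of_carrier)
  also have "\<dots> \<longleftrightarrow> (a * a mod int p) [^]\<^bsub>?R\<^esub> k = 1"
    using aa by (simp add: units_of_pow units_of_one res_mult_eq res_one_eq)
  also have "\<dots> \<longleftrightarrow> [(a * a) ^ k = 1] (mod int p)"
    using m_gt_one pow_cong[of "a * a" k] by (simp add: cong_def)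
  also have "\<dots> \<longleftrightarrow> int p dvd (a ^ k - 1) * (a ^ k + 1)"
    by (simp add: cong_iff_dvd_diff power_mult_distrib algebra_simps)
  also have "\<dots> \<longleftrightarrow> [a ^ k = 1] (mod int p) \<or> [a ^ k = - 1] (mod int p)"
    using p by (simp add: cong_iff_dvd_diff prime_dvd_mult_iff)
  finally show ?thesis .
qed

theorem theorem5:
  fixes p N :: nat and a :: int and C H :: "(nat \<Rightarrow> nat) set"
  assumes "prime p" and "p \<ge> 5"
    and "a \<in> Units (residue_ring (int p))" and "panmagic_unit p a"
    and "N = group.ord (units_of (residue_ring (int p))) (a \<otimes>\<^bsub>residue_ring (int p)\<^esub> a) + 1"
    and "C = mult_perm p a <#\<^bsub>sym_group p\<^esub> dihedral p"
    and "H = generate (sym_group p) (insert (mult_perm p a) (dihedral p))"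
  shows "(\<forall>\<sigma>\<in>C. panmagic_perm p \<sigma>) \<and>
         strictly_nary (sym_group p) C N \<and>
         H = (\<Union>i\<in>{1..N - 1}. set_power (sym_group p) C i) \<and>
         dihedral p \<lhd> (sym_group p)\<lparr>carrier := H\<rparr> \<and>
         ((sym_group p)\<lparr>carrier := H\<rparr>) Mod dihedral p \<cong> integer_mod_group (N - 1)"
proof -
  let ?R = "residue_ring (int p)" and ?S = "sym_group p" and ?D = "dihedral p" and ?x = "mult_perm p a"
  have p1: "p \<ge> 1" and p2: "p \<ge> 2"
    using assms(2) by auto
  interpret residues "int p" ?R
    using p2 by unfold_locales simp
  note coprime_a = panmagic_unit_coprime[OF p2 assms(4)]
  have "group.ord (units_of ?R) (a \<otimes>\<^bsub>?R\<^esub> a) \<ge> 1"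
    using assms(3) group.ord_ge_1[OF units_group, of "a \<otimes>\<^bsub>?R\<^esub> a"] by (simp add: units_of_carrier)
  then have m_pos: "N - 1 > 0"
    by (simp add: assms(5))
  have pow_iff: "?x [^]\<^bsub>?S\<^esub> (k::nat) \<in> ?D \<longleftrightarrow> N - 1 dvd k" for k
    using ord_square_dvd_iff[OF assms(1,3), of k]
    by (simp add: mult_perm_pow affine_in_dihedral_iff[OF p1] assms(5))
  interpret normalizing_element ?S ?D ?x "N - 1"
  proof (intro normalizing_element.intro normalizing_element_axioms.intro)
    show "group ?S" by (rule sym_group_is_group)
    show "subgroup ?D ?S" by (rule dihedral_subgroup)
    show "?x \<in> carrier ?S"
      unfolding mult_perm_eq_affine using coprime_a(1) by (rule affine_in_sym_group)
    show "?x <#\<^bsub>?S\<^esub> ?D = ?D #>\<^bsub>?S\<^esub> ?x"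
      unfolding mult_perm_lcoset_dihedral[OF p1 coprime_a(1)] mult_perm_rcoset_dihedral[OF p1] ..
    show "N - 1 > 0" by (rule m_pos)
    show "?x [^]\<^bsub>?S\<^esub> (k::nat) \<in> ?D \<longleftrightarrow> N - 1 dvd k" for k by (rule pow_iff)
  qed
  have "panmagic_perm p \<sigma>" if "\<sigma> \<in> C" for \<sigma>
  proof -
    have "\<exists>u b. \<sigma> = affine_perm p (a * u) b \<and> u \<in> {1, -1}"
      using that by (simp only: assms(6) mult_perm_lcoset_dihedral[OF p1 coprime_a(1)] mem_Collect_eq)
    then obtain u b where \<sigma>: "\<sigma> = affine_perm p (a * u) b" and "u \<in> {1, -1}"
      by metis
    then have u: "u = 1 \<or> u = -1" by simp
    have "- a + 1 = - (a - 1)" "- a - 1 = - (a + 1)" by simp_all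
    then have "coprime (- a) (int p)" "coprime (- a + 1) (int p)" "coprime (- a - 1) (int p)"
      using coprime_a by (simp_all only: coprime_minus_left_iff)
    then show ?thesis
      using u coprime_a unfolding \<sigma> by (elim disjE) (simp_all add: panmagic_affine_perm[OF p1])
  qed
  then have "\<forall>\<sigma>\<in>C. panmagic_perm p \<sigma>" ..
  moreover have "strictly_nary ?S C N"
    using strictly_nary_coset m_pos by (simp add: assms(6))
  ultimately show ?thesis
    using generate_eq_Union_set_power normal_in_generate generate_Mod_iso
    unfolding assms(6,7) by (intro conjI)
qed

end
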